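(* Let $\lambda_*\approx 0.6478$ be the real root of $x^3-x^2+x=\frac12$. If $\lambda\in[\lambda_*,2/3)$, then $\mathcal{S}_\lambda$ has non-empty interior and, moreover, each hole is radial.
   Context: Let $\mathbf p_k=\frac23(\cos(2\pi k/3),\sin(2\pi k/3))\in\mathbb{R}^2$, $k=0,1,2$, and let $\Delta$ be the closed (filled) equilateral triangle with vertices $\mathbf p_0,\mathbf p_1,\mathbf p_2$. For $\lambda\in(0,1)$ let $f_i(\mathbf x)=\lambda\mathbf x+(1-\lambda)\mathbf p_i$, $i=0,1,2$. The invariant set $\mathcal{S}_\lambda\subset\Delta$ is the unique non-empty compact set with $\mathcal{S}_\lambda=\bigcup_{i=0}^2 f_i(\mathcal{S}_\lambda)$. A hole is a connected component of $\Delta\setminus\mathcal{S}_\lambda$. The central hole is $H_0=\Delta\setminus\bigcup_{i=0}^2 f_i(\Delta)$. A hole is called radial if it is of the form $f_i^n(H_0)$ for some $i\in\{0,1,2\}$ and some $n\ge0$, where $f_i^n$ is the $n$-fold iterate of $f_i$. *)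

theory Defs
  imports "HOL-Analysis.Analysis"
begin

definition vertex :: "nat \<Rightarrow> real ^ 2" where
  "vertex k = (2/3) *\<^sub>R vector [cos (2 * pi * real k / 3), sin (2 * pi * real k / 3)]"

definition triangle :: "(real ^ 2) set" where
  "triangle = convex hull {vertex 0, vertex 1, vertex 2}"

definition contr :: "real \<Rightarrow> nat \<Rightarrow> real ^ 2 \<Rightarrow> real ^ 2" where
  "contr l i x = l *\<^sub>R x + (1 - l) *\<^sub>R vertex i"

definition is_invariant_set :: "real \<Rightarrow> (real ^ 2) set \<Rightarrow> bool" where
  "is_invariant_set l S \<longleftrightarrow>
     S \<noteq> {} \<and> compact S \<and> S = (\<Union>i\<in>{0,1,2}. contr l i ` S)"

text \<open>The description is meaningful for \<open>0 < l < 1\<close>: see \<open>ex1_invariant_set\<close> below.\<close>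

definition invariant_set :: "real \<Rightarrow> (real ^ 2) set" where
  "invariant_set l = (THE S. is_invariant_set l S)"

definition is_hole :: "real \<Rightarrow> (real ^ 2) set \<Rightarrow> bool" where
  "is_hole l H \<longleftrightarrow> H \<in> components (triangle - invariant_set l)"

definition central_hole :: "real \<Rightarrow> (real ^ 2) set" where
  "central_hole l = triangle - (\<Union>i\<in>{0,1,2}. contr l i ` triangle)"

definition is_radial :: "real \<Rightarrow> (real ^ 2) set \<Rightarrow> bool" where
  "is_radial l H \<longleftrightarrow> (\<exists>i\<in>{0,1,2}. \<exists>n. H = (contr l i ^^ n) ` central_hole l)"

definition lambda_star :: real where
  "lambda_star = (THE x. x^3 - x^2 + x = 1/2)"


subsection \<open>The two definite descriptions are well defined\<close>

lemma contr_dist: "dist (contr l i x) (contr l i y) = \<bar>l\<bar> * dist x y"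
  by (simp add: contr_def dist_norm flip: scaleR_diff_right)

lemma continuous_on_contr [continuous_intros]: "continuous_on A (contr l i)"
  unfolding contr_def by (intro continuous_intros)

lemma invariant_set_le:
  assumes l: "0 < l" "l < 1" and S: "is_invariant_set l S" and T: "is_invariant_set l T"
  shows "S \<subseteq> T"
proof -
  have S': "S \<noteq> {}" "compact S" "S = (\<Union>i\<in>{0,1,2}. contr l i ` S)"
    and T': "T \<noteq> {}" "compact T" "T = (\<Union>i\<in>{0,1,2}. contr l i ` T)"
    using S T unfolding is_invariant_set_def by blast+
  have "continuous_on S (\<lambda>x. infdist x T)" by (intro continuous_intros)
  then obtain s where s: "s \<in> S" "\<And>x. x \<in> S \<Longrightarrow> infdist x T \<le> infdist s T"
    using continuous_attains_sup[OF S'(2,1)] by blast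
  from s(1) S'(3) obtain i s' where i: "i \<in> {0,1,2}" "s' \<in> S" "s = contr l i s'" by blast
  obtain t where t: "t \<in> T" "infdist s' T = dist s' t"
    using infdist_attains_inf[OF compact_imp_closed[OF T'(2)] T'(1)] by blast
  have "contr l i t \<in> T" using T'(3) i(1) t(1) by blast
  hence "infdist s T \<le> dist s (contr l i t)" by (rule infdist_le)
  also have "\<dots> = l * infdist s' T" using l i(3) t(2) by (simp add: contr_dist)
  also have "\<dots> \<le> l * infdist s T" using l s(2)[OF i(2)] by simp
  finally have "(1 - l) * infdist s T \<le> 0" by (simp add: algebra_simps)
  hence "infdist s T \<le> 0" using l by (simp add: mult_le_0_iff)
  hence "\<And>x. x \<in> S \<Longrightarrow> infdist x T = 0"
    using s(2) infdist_nonneg by (meson order.antisym order.trans)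
  thus ?thesis
    using in_closed_iff_infdist_zero[OF compact_imp_closed[OF T'(2)] T'(1)] by blast
qed

lemma contr_triangle:
  assumes "0 < l" "l < 1" "i \<in> {0,1,2}" "x \<in> triangle"
  shows "contr l i x \<in> triangle"
proof -
  have "vertex i \<in> triangle" unfolding triangle_def using assms(3) by (intro hull_inc) auto
  thus ?thesis unfolding contr_def using assms convex_convex_hull
    by (intro convexD) (auto simp: triangle_def)
qed

lemma ex_invariant_set:
  assumes l: "0 < l" "l < 1"
  shows "\<exists>S \<subseteq> triangle. is_invariant_set l S"
proof -
  define F where "F = (\<lambda>A. \<Union>i\<in>{0,1,2}. contr l i ` A)"
  define D where "D = (\<lambda>n. (F ^^ n) triangle)"
  have D0: "D 0 = triangle" and DS: "\<And>n. D (Suc n) = F (D n)" by (auto simp: D_def)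
  have ne: "D n \<noteq> {}" for n
    by (induction n) (auto simp: D0 DS F_def triangle_def)
  have cp: "compact (D n)" for n
  proof (induction n)
    case 0 show ?case unfolding D0 triangle_def by (intro finite_imp_compact_convex_hull) auto
  next
    case (Suc n) thus ?case unfolding DS F_def
      by (intro compact_UN compact_continuous_image continuous_intros) auto
  qed
  have Suc_le: "D (Suc n) \<subseteq> D n" for n
  proof (induction n)
    case 0 show ?case unfolding DS D0 F_def using contr_triangle[OF l] by blast
  next
    case (Suc n) thus ?case unfolding DS[of "Suc n"] DS[of n] F_def by blast
  qed
  have mono: "m \<le> n \<Longrightarrow> D n \<subseteq> D m" for m n
    by (rule lift_Suc_antimono_le[of D]) (use Suc_le in auto)
  define S where "S = (\<Inter>n. D n)"
  have "S \<noteq> {}" unfolding S_def using cp ne mono by (rule compact_nest)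
  moreover have "compact S" unfolding S_def using cp by (intro compact_Inter) auto
  moreover have "S \<subseteq> F S"
  proof
    fix x assume x: "x \<in> S"
    have "\<exists>i\<in>{0,1,2}. x \<in> contr l i ` D n" for n
      using x DS[of n] unfolding S_def F_def by blast
    then obtain g where g: "\<And>n. g n \<in> {0,1,2::nat}" "\<And>n. x \<in> contr l (g n) ` D n" by metis
    have "range g \<subseteq> {0,1,2}" by (intro image_subsetI g(1))
    hence "finite (range g)" by (rule finite_subset) simp
    then obtain i where i: "infinite {n. g n = i}"
      using pigeonhole_infinite[of UNIV g] by auto
    have all: "x \<in> contr l i ` D n" for n
    proof -
      obtain m where "m > n" "g m = i" using i unfolding infinite_nat_iff_unbounded by blast
      thus ?thesis using g(2)[of m] mono[of n m] by auto
    qed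
    have i3: "i \<in> {0,1,2}" using i g(1) by (metis (mono_tags) Collect_empty_eq finite.emptyI)
    have inj: "contr l i y = contr l i z \<Longrightarrow> y = z" for y z
      using l by (simp add: contr_def)
    obtain y where y: "x = contr l i y" using all[of 0] by blast
    have "y \<in> S" unfolding S_def using all y inj by blast
    thus "x \<in> F S" unfolding F_def using i3 y by blast
  qed
  moreover have "F S \<subseteq> S"
  proof -
    have "F S \<subseteq> D n" for n
    proof -
      have "F S \<subseteq> F (D n)" unfolding F_def S_def by blast
      thus ?thesis using DS Suc_le by blast
    qed
    thus ?thesis unfolding S_def by blast
  qed
  moreover have "S \<subseteq> triangle" unfolding S_def using D0 by blast
  ultimately show ?thesis unfolding is_invariant_set_def F_def by blast
qed

lemma ex1_invariant_set:
  assumes "0 < l" "l < 1"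
  shows "\<exists>!S. is_invariant_set l S"
  using ex_invariant_set[OF assms] invariant_set_le[OF assms] by (metis subset_antisym)

lemma is_invariant_set_invariant_set:
  assumes "0 < l" "l < 1"
  shows "is_invariant_set l (invariant_set l)"
  unfolding invariant_set_def by (rule theI'[OF ex1_invariant_set[OF assms]])

lemma invariant_set_subset_triangle:
  assumes "0 < l" "l < 1"
  shows "invariant_set l \<subseteq> triangle"
  using ex_invariant_set[OF assms] ex1_invariant_set[OF assms]
    is_invariant_set_invariant_set[OF assms] by blast

lemma cubic_strict_mono:
  fixes x y :: real
  assumes "x < y"
  shows "x^3 - x^2 + x < y^3 - y^2 + y"
proof -
  have "y^3 - y^2 + y - (x^3 - x^2 + x) =
      (y - x) * ((x + y - 1)^2 / 2 + x^2 / 2 + y^2 / 2 + 1/2)"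
    by (simp add: power2_eq_square power3_eq_cube field_simps)
  moreover have "(x + y - 1)^2 / 2 + x^2 / 2 + y^2 / 2 + 1/2 > 0"
    by (intro add_nonneg_pos add_nonneg_nonneg) auto
  ultimately show ?thesis using assms by (metis diff_gt_0_iff_gt mult_pos_pos)
qed

lemma ex1_lambda_star: "\<exists>!x::real. x^3 - x^2 + x = 1/2"
proof (rule ex_ex1I)
  have "\<exists>x\<ge>0. x \<le> 1 \<and> x^3 - x^2 + x = (1/2::real)"
    by (rule IVT') (auto intro!: continuous_intros)
  thus "\<exists>x::real. x^3 - x^2 + x = 1/2" by blast
qed (metis cubic_strict_mono less_irrefl linorder_neqE)

lemma lambda_star_root: "lambda_star^3 - lambda_star^2 + lambda_star = 1/2"
  unfolding lambda_star_def by (rule theI'[OF ex1_lambda_star])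

lemma lambda_star_less:
  fixes x :: real
  assumes "1/2 < x^3 - x^2 + x"
  shows "lambda_star < x"
  using assms cubic_strict_mono[of x lambda_star] lambda_star_root
  by (cases lambda_star x rule: linorder_cases) auto

lemma less_lambda_star:
  fixes x :: real
  assumes "x^3 - x^2 + x < 1/2"
  shows "x < lambda_star"
  using assms cubic_strict_mono[of lambda_star x] lambda_star_root
  by (cases lambda_star x rule: linorder_cases) auto

lemma lambda_star_approx: "\<bar>lambda_star - 0.6478\<bar> < 0.00005"
proof -
  have "lambda_star < 0.64785"
    by (rule lambda_star_less) (simp add: power2_eq_square power3_eq_cube)
  moreover have "0.64775 < lambda_star"
    by (rule less_lambda_star) (simp add: power2_eq_square power3_eq_cube)
  ultimately show ?thesis unfolding abs_less_iff by simp
qed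

end

theory Submission
  imports Defs
begin

text \<open>
  In barycentric coordinates \<open>b\<^sub>0 + b\<^sub>1 + b\<^sub>2 = 1\<close> the triangle is given by \<open>b\<^sub>i \<ge> 0\<close>, the map
  \<open>f\<^sub>i\<close> multiplies all coordinates by \<open>l\<close> and adds \<open>1 - l\<close> to \<open>b\<^sub>i\<close>, the cell \<open>f\<^sub>i(\<Delta>)\<close> is the part of
  the triangle where \<open>b\<^sub>i \<ge> 1 - l\<close>, and the central hole \<open>H\<^sub>0\<close> is the open triangle on which all
  \<open>b\<^sub>i < 1 - l\<close>. Every radial hole is then described by three strict linear inequalities, so all
  geometric claims become inequalities between polynomials in \<open>l\<close>.

  Let the sieve be the triangle with only the radial holes removed; the point is that it equals the
  invariant set \<open>S\<close>. A radial hole towards vertex \<open>i\<close> misses the cells at the other two vertices, so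
  pulling a point of \<open>S\<close> in it back along \<open>f\<^sub>i\<close> repeatedly would produce a point of \<open>S\<close> in \<open>H\<^sub>0\<close>,
  which is impossible: hence \<open>S\<close> lies in the sieve. Conversely, a bounded set that is contained in
  the union of its images under the \<open>f\<^sub>i\<close> lies in \<open>S\<close> (\<open>subset_invariant_setI\<close>), so it is enough to find,
  for each point of the sieve, a preimage in the sieve (\<open>sieve_subset_images\<close>). The point lies in
  some cell \<open>f\<^sub>i(\<Delta>)\<close>, and its preimage there can fail to be in the sieve only if the point lies in a
  cross hole \<open>f\<^sub>i(f\<^sub>j\<^sup>n(H\<^sub>0))\<close> with \<open>j \<noteq> i\<close> and \<open>n \<ge> 1\<close>. Two facts rescue such a point. First, the cross hole
  is contained in the other cell \<open>f\<^sub>j(\<Delta>)\<close> (\<open>cross_hole_in_cell\<close>); for \<open>n = 1\<close> this is the inequality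
  \<open>l\<^sup>3 - l\<^sup>2 + l \<ge> 1/2\<close>, which is where the bound \<open>lambda_star\<close> comes from. Secondly, it is disjoint from all
  cross holes \<open>f\<^sub>j(f\<^sub>i\<^sup>m(H\<^sub>0))\<close> (\<open>cross_holes_disjoint\<close>); the cross holes
  \<open>f\<^sub>j(f\<^sub>k\<^sup>m(H\<^sub>0))\<close> of the third vertex \<open>k\<close> lie in the cell \<open>f\<^sub>k(\<Delta>)\<close>, which the first cross hole does not meet. So the
  preimage in the cell \<open>f\<^sub>j(\<Delta>)\<close> is in the sieve.

  Thus \<open>\<Delta> - S\<close> is the union of the radial holes. These are open, convex, nonempty (because \<open>l < 2/3\<close>)
  and two of them are equal or disjoint, so they are exactly the components. No radial hole reaches
  the region near the middle of the edge \<open>b\<^sub>2 = 0\<close> where both \<open>b\<^sub>0\<close> and \<open>b\<^sub>1\<close> exceed \<open>1 - l\<close>, which gives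
  the interior.
\<close>

section \<open>Barycentric coordinates\<close>

text \<open>
  The vertices have norm \<open>2/3\<close>, mutual inner products \<open>-2/9\<close> and sum zero; this makes the affine
  function below the barycentric coordinate that is 1 at vertex \<open>i\<close> and 0 at the others.
\<close>

definition bary :: "nat \<Rightarrow> real ^ 2 \<Rightarrow> real" where
  "bary i x = 1/3 + 3/2 * (vertex i \<bullet> x)"

lemma vertex_components:
  "vertex 0 $ 1 = 2/3" "vertex 0 $ 2 = 0"
  "vertex 1 $ 1 = -1/3" "vertex 1 $ 2 = sqrt 3 / 3"
  "vertex 2 $ 1 = -1/3" "vertex 2 $ 2 = - sqrt 3 / 3"
proof -
  have four: "2 * pi * 2 / 3 = 2 * (2 * pi / 3)" by simp
  have "cos (2 * pi * 2 / 3) = -1/2" "sin (2 * pi * 2 / 3) = - sqrt 3 / 2"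
    unfolding four cos_double sin_double cos_120 sin_120 by (auto simp: power2_eq_square)
  thus "vertex 0 $ 1 = 2/3" "vertex 0 $ 2 = 0"
    "vertex 1 $ 1 = -1/3" "vertex 1 $ 2 = sqrt 3 / 3"
    "vertex 2 $ 1 = -1/3" "vertex 2 $ 2 = - sqrt 3 / 3"
    by (auto simp: vertex_def cos_120 sin_120)
qed

lemma vertex_inner_vertex:
  assumes "i \<in> {0,1,2}" "j \<in> {0,1,2}"
  shows "vertex i \<bullet> vertex j = (if i = j then 4/9 else -2/9)"
  using assms by (auto simp: inner_vec_def sum_2 vertex_components simp del: One_nat_def)

lemma bary_vertex:
  assumes "i \<in> {0,1,2}" "j \<in> {0,1,2}"
  shows "bary i (vertex j) = (if i = j then 1 else 0)"
  unfolding bary_def vertex_inner_vertex[OF assms] by simp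

lemma bary_sum: "bary 0 x + bary 1 x + bary 2 x = 1"
  by (simp add: bary_def inner_vec_def sum_2 vertex_components field_simps
      del: One_nat_def)

lemma bary_affine: "bary i (a *\<^sub>R x + b *\<^sub>R y) = a * bary i x + b * bary i y + (1 - a - b) / 3"
  by (simp add: bary_def inner_add_right field_simps)

lemma bary_combination: "x = bary 0 x *\<^sub>R vertex 0 + bary 1 x *\<^sub>R vertex 1 + bary 2 x *\<^sub>R vertex 2"
  by (simp add: vec_eq_iff forall_2 bary_def inner_vec_def sum_2 vertex_components
      field_simps del: One_nat_def)

lemma continuous_on_bary [continuous_intros]: "continuous_on A (bary i)"
  unfolding bary_def by (intro continuous_intros)

lemma open_bary_less: "open {x. bary i x < c}" and open_bary_greater: "open {x. c < bary i x}"
  by (intro open_Collect_less continuous_intros)+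

lemma convex_bary_less: "convex {x. bary i x < c}"
proof -
  have "{x. bary i x < c} = {x. vertex i \<bullet> x < (c - 1/3) * (2/3)}"
    by (auto simp: bary_def field_simps)
  thus ?thesis by (simp only: convex_halfspace_lt)
qed

lemma triangle_bary: "x \<in> triangle \<longleftrightarrow> (\<forall>i\<in>{0,1,2}. 0 \<le> bary i x)"
proof
  have "triangle \<subseteq> {x. 0 \<le> bary i x}" if "i \<in> {0,1,2}" for i
  proof -
    have "{x. 0 \<le> bary i x} = {x. vertex i \<bullet> x \<ge> -2/9}"
      by (auto simp: bary_def field_simps)
    hence "convex {x. 0 \<le> bary i x}"
      by (simp only: convex_halfspace_ge)
    thus ?thesis unfolding triangle_def
      by (intro hull_minimal) (use that in \<open>auto simp: bary_vertex[OF that]\<close>)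
  qed
  thus "\<forall>i\<in>{0,1,2}. 0 \<le> bary i x" if "x \<in> triangle" using that by blast
next
  assume "\<forall>i\<in>{0,1,2}. 0 \<le> bary i x"
  thus "x \<in> triangle" unfolding triangle_def convex_hull_3
    using bary_combination[of x] bary_sum[of x] by blast
qed

text \<open>
  Provides the symmetry of the argument: with the third index named, one pair \<open>i \<noteq> j\<close> represents all
  six ordered pairs of vertices.
\<close>

lemma obtain_third_index:
  assumes "i \<in> {0,1,2}" "j \<in> {0,1,2}" "i \<noteq> j"
  obtains k where "{0,1,2} = {i,j,k::nat}" "k \<noteq> i" "k \<noteq> j"
    "\<And>x. bary i x + bary j x + bary k x = 1"
proof -
  have "{0,1,2} = {i,j,3-i-j} \<and> 3-i-j \<noteq> i \<and> 3-i-j \<noteq> j \<and> (\<forall>x. bary i x + bary j x + bary (3-i-j) x = 1)"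
    using assms bary_sum by (auto simp: numeral_2_eq_2 numeral_3_eq_3 algebra_simps)
  thus ?thesis using that by blast
qed

lemma bary_contr:
  assumes "i \<in> {0,1,2}" "j \<in> {0,1,2}"
  shows "bary i (contr l j x) = l * bary i x + (if i = j then 1 - l else 0)"
  by (simp add: contr_def bary_affine bary_vertex[OF assms])

lemma bary_contr_triangle_ge:
  assumes "0 < l" "i \<in> {0,1,2}" "q \<in> triangle"
  shows "1 - l \<le> bary i (contr l i q)"
proof -
  have "0 \<le> bary i q" using assms(2,3) unfolding triangle_bary by blast
  thus ?thesis using assms(1) by (simp add: bary_contr[OF assms(2,2)])
qed

lemma contr_triangle_preimage:
  assumes l: "0 < l" "l < 1" and i: "i \<in> {0,1,2}" and x: "x \<in> triangle" "1 - l \<le> bary i x"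
  obtains q where "q \<in> triangle" "x = contr l i q"
proof -
  define q where "q = (1/l) *\<^sub>R (x - (1-l) *\<^sub>R vertex i)"
  have xq: "x = contr l i q" using l by (simp add: q_def contr_def)
  have "0 \<le> bary j q" if j: "j \<in> {0,1,2}" for j
  proof -
    have "0 \<le> bary j x" using x(1) j unfolding triangle_bary by blast
    hence "0 \<le> l * bary j q" using x(2) bary_contr[OF j i, of l q] unfolding xq[symmetric] by (auto split: if_splits)
    thus ?thesis using l by (simp add: zero_le_mult_iff)
  qed
  hence "q \<in> triangle" by (simp add: triangle_bary)
  with xq that show ?thesis by blast
qed

section \<open>Radial holes in barycentric coordinates\<close>

text \<open>
  This is \<open>f\<^sub>i\<^sup>n(H\<^sub>0)\<close>, as \<open>funpow_contr_central_hole\<close> shows: applying \<open>f\<^sub>i\<close> to the conditions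
  \<open>b\<^sub>j < 1 - l\<close> scales the two bounds for \<open>j \<noteq> i\<close> by \<open>l\<close>, and scales the distance from 1 of the bound
  for \<open>b\<^sub>i\<close> by \<open>l\<close>. Membership in the triangle follows from the three upper bounds if \<open>l > 1/2\<close>.
\<close>

definition radial_hole :: "real \<Rightarrow> nat \<Rightarrow> nat \<Rightarrow> (real ^ 2) set" where
  "radial_hole l i n =
     {x. bary i x < 1 - l ^ Suc n \<and> (\<forall>j\<in>{0,1,2}-{i}. bary j x < l ^ n * (1 - l))}"

lemma power_mult_one_minus_le:
  assumes "0 < l" "l < 1"
  shows "l ^ n * (1 - l) \<le> 1 - (l::real)"
  using mult_right_mono[of "l ^ n" 1 "1 - l"] power_le_one[of l n] assms by simp

lemma radial_hole_0: "i \<in> {0,1,2} \<Longrightarrow> radial_hole l i 0 = {x. \<forall>j\<in>{0,1,2}. bary j x < 1 - l}"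
  by (auto simp: radial_hole_def)

lemma contr_mem_radial_hole_Suc:
  assumes "0 < l" "i \<in> {0,1,2}"
  shows "contr l i x \<in> radial_hole l i (Suc n) \<longleftrightarrow> x \<in> radial_hole l i n"
proof -
  have "bary i (contr l i x) < 1 - l ^ Suc (Suc n) \<longleftrightarrow> l * bary i x < l * (1 - l ^ Suc n)"
    by (simp add: bary_contr[OF assms(2,2)] algebra_simps)
  moreover have "bary j (contr l i x) < l ^ Suc n * (1 - l) \<longleftrightarrow> l * bary j x < l * (l ^ n * (1 - l))"
    if "j \<in> {0,1,2}-{i}" for j
    using that assms by (simp add: bary_contr algebra_simps)
  ultimately show ?thesis using assms(1)
    unfolding radial_hole_def by (simp only: mem_Collect_eq mult_less_cancel_left_pos cong: ball_cong)
qed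

lemma radial_hole_Suc:
  assumes l: "0 < l" and i: "i \<in> {0,1,2}"
  shows "radial_hole l i (Suc n) = contr l i ` radial_hole l i n"
proof -
  have "x = contr l i ((1/l) *\<^sub>R (x - (1-l) *\<^sub>R vertex i))" for x
    using l by (simp add: contr_def)
  thus ?thesis using contr_mem_radial_hole_Suc[OF l i] by (metis (no_types, lifting) image_eqI image_subsetI subsetI subset_antisym)
qed

text \<open>
  As the coordinates sum to 1, the upper bounds on the other two coordinates yield a lower bound on
  each one; \<open>l > 1/2\<close> makes the lower bounds for \<open>j \<noteq> i\<close> positive.
\<close>

lemma radial_hole_coords:
  assumes l: "1/2 < l" "l < 1" and x: "x \<in> radial_hole l i n"
    and ij: "i \<in> {0,1,2}" "j \<in> {0,1,2}" "j \<noteq> i"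
  shows "1 - 2 * (l ^ n * (1 - l)) < bary i x" "0 < bary j x"
    "bary i x < 1 - l ^ Suc n" "bary j x < l ^ n * (1 - l)"
proof -
  obtain k where k: "{0,1,2} = {j,i,k}" "k \<noteq> j" "k \<noteq> i" "\<And>x. bary j x + bary i x + bary k x = 1"
    using obtain_third_index[OF ij(2,1,3)] by blast
  have "k \<in> {0,1,2}" unfolding k(1) by simp
  hence b: "bary i x < 1 - l ^ Suc n" "bary j x < l ^ n * (1 - l)" "bary k x < l ^ n * (1 - l)"
    using x ij(2,3) k(3) by (simp_all add: radial_hole_def)
  have "0 < l ^ n * (2 * l - 1)" using l by simp
  thus "1 - 2 * (l ^ n * (1 - l)) < bary i x" "0 < bary j x"
    "bary i x < 1 - l ^ Suc n" "bary j x < l ^ n * (1 - l)"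
    using b k(4)[of x] by (simp_all add: algebra_simps)
qed

lemma radial_hole_subset_triangle:
  assumes l: "1/2 < l" "l < 1" and i: "i \<in> {0,1,2}"
  shows "radial_hole l i n \<subseteq> triangle"
proof
  fix x assume x: "x \<in> radial_hole l i n"
  define c where "c = l ^ n * (1 - l)"
  have "c \<le> 1 - l" unfolding c_def using l by (intro power_mult_one_minus_le) auto
  moreover obtain j where j: "j \<in> {0,1,2}" "j \<noteq> i" using i by force
  ultimately have "0 < bary i x"
    using radial_hole_coords(1)[OF l x i j, folded c_def] l by linarith
  moreover have "0 < bary k x" if "k \<in> {0,1,2}" "k \<noteq> i" for k
    using radial_hole_coords(2)[OF l x i that] .
  ultimately show "x \<in> triangle" unfolding triangle_bary by (metis less_imp_le)
qed

lemma central_hole_eq: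
  assumes l: "1/2 < l" "l < 1" and i: "i \<in> {0,1,2}"
  shows "central_hole l = radial_hole l i 0"
proof -
  have "x \<in> contr l j ` triangle \<longleftrightarrow> 1 - l \<le> bary j x" if xj: "x \<in> triangle" "j \<in> {0,1,2}" for x j
  proof
    assume "x \<in> contr l j ` triangle"
    thus "1 - l \<le> bary j x" using bary_contr_triangle_ge[OF _ xj(2)] l by auto
  next
    assume j: "1 - l \<le> bary j x"
    obtain q where "q \<in> triangle" "x = contr l j q"
      using contr_triangle_preimage[OF _ l(2) xj(2,1) j] l(1) by auto
    thus "x \<in> contr l j ` triangle" by blast
  qed
  hence "x \<in> central_hole l \<longleftrightarrow> x \<in> triangle \<inter> radial_hole l i 0" for x
    unfolding central_hole_def radial_hole_0[OF i] not_le[symmetric] Diff_iff UN_iff Int_iff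
      mem_Collect_eq by metis
  thus ?thesis using radial_hole_subset_triangle[OF assms] by blast
qed

lemma funpow_contr_central_hole:
  assumes l: "1/2 < l" "l < 1" and i: "i \<in> {0,1,2}"
  shows "(contr l i ^^ n) ` central_hole l = radial_hole l i n"
proof (induction n)
  case 0 show ?case using central_hole_eq[OF assms] by simp
next
  case (Suc n)
  thus ?case using l radial_hole_Suc[OF _ i, of l n] by (simp add: image_image[symmetric])
qed

lemma radial_hole_outside_cell:
  assumes l: "1/2 < l" "l < 1" and x: "x \<in> radial_hole l i n"
    and ij: "i \<in> {0,1,2}" "j \<in> {0,1,2}" "j \<noteq> i"
  shows "bary j x < 1 - l"
proof -
  have "l ^ n * (1 - l) \<le> 1 - l" using l by (intro power_mult_one_minus_le) auto
  thus ?thesis using radial_hole_coords(4)[OF assms] by simp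
qed

text \<open>
  A point of the invariant set has a preimage in the invariant set under some \<open>f\<^sub>j\<close>. If it is in
  \<open>f\<^sub>i\<^sup>n(H\<^sub>0)\<close> with \<open>n > 0\<close>, then \<open>j = i\<close>, since the hole misses the other cells, and the preimage is in
  \<open>f\<^sub>i\<^sup>n\<^sup>-\<^sup>1(H\<^sub>0)\<close>. The induction ends at \<open>H\<^sub>0\<close>, which no cell meets.
\<close>

lemma radial_hole_disjoint_invariant_set:
  assumes l: "1/2 < l" "l < 1" and i: "i \<in> {0,1,2}"
  shows "radial_hole l i n \<inter> invariant_set l = {}"
proof (induction n)
  have l01: "0 < l" "l < 1" using l by auto
  have S: "\<exists>j\<in>{0,1,2}. \<exists>y\<in>invariant_set l. y \<in> triangle \<and> x = contr l j y" if "x \<in> invariant_set l" for x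
    using that is_invariant_set_invariant_set[OF l01] invariant_set_subset_triangle[OF l01]
    unfolding is_invariant_set_def by blast
  {
    case 0
    show ?case using S bary_contr_triangle_ge[OF l01(1)] unfolding radial_hole_0[OF i] by fastforce
  next
    case (Suc n)
    have False if x: "x \<in> radial_hole l i (Suc n)" "x \<in> invariant_set l" for x
    proof -
      obtain j y where j: "j \<in> {0,1,2}" "y \<in> invariant_set l" "y \<in> triangle" "x = contr l j y"
        using S[OF x(2)] by blast
      have "j = i" using radial_hole_outside_cell[OF l x(1) i j(1)] bary_contr_triangle_ge[OF l01(1) j(1,3)] j(4) by force
      hence "y \<in> radial_hole l i n" using x(1) j contr_mem_radial_hole_Suc[OF l01(1) i] by simp
      thus False using Suc j by blast
    qed
    thus ?case by blast
  }
qed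

lemma radial_hole_eq_Int:
  "radial_hole l i n =
    {x. bary i x < 1 - l ^ Suc n} \<inter> (\<Inter>j\<in>{0,1,2}-{i}. {x. bary j x < l ^ n * (1 - l)})"
  by (auto simp: radial_hole_def)

lemma radial_hole_open: "open (radial_hole l i n)"
  unfolding radial_hole_eq_Int by (auto intro!: open_Int open_INT open_bary_less)

lemma radial_hole_convex: "convex (radial_hole l i n)"
  unfolding radial_hole_eq_Int by (auto intro!: convex_Int convex_INT convex_bary_less)

text \<open>The origin is the centroid; all its coordinates are \<open>1/3\<close>, which is below \<open>1 - l\<close> if \<open>l < 2/3\<close>.\<close>

lemma radial_hole_nonempty:
  assumes l: "0 < l" "l < 2/3" and i: "i \<in> {0,1,2}"
  shows "radial_hole l i n \<noteq> {}"
proof (induction n)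
  case 0
  have "0 \<in> radial_hole l i 0" using l unfolding radial_hole_0[OF i] by (simp add: bary_def)
  thus ?case by blast
qed (simp add: radial_hole_Suc[OF l(1) i])

text \<open>
  Holes towards the same vertex are separated by their \<open>i\<close>-th coordinate. A hole at level \<open>m > 0\<close>
  towards \<open>i\<close> lies in the cell \<open>f\<^sub>i(\<Delta>)\<close>, which holes towards other vertices avoid. What is left is
  \<open>H\<^sub>0\<close>, which occurs as level 0 for all three vertices.
\<close>

lemma radial_hole_disjoint:
  assumes l: "1/2 < l" "l < 1" and ij: "i \<in> {0,1,2}" "j \<in> {0,1,2}"
    and x: "x \<in> radial_hole l i m" "x \<in> radial_hole l j n"
  shows "radial_hole l i m = radial_hole l j n"
proof -
  have level: "m = n" if lev: "i \<in> {0,1,2}" "x \<in> radial_hole l i m" "x \<in> radial_hole l i n" "m \<le> n" for i m n and x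
  proof (rule ccontr)
    assume "m \<noteq> n"
    hence "l ^ n \<le> l ^ Suc m" using l lev(4) by (intro power_decreasing) auto
    hence "l ^ n * (2 * (1 - l)) \<le> l ^ Suc m * 1" using l by (intro mult_mono) auto
    hence "2 * (l ^ n * (1 - l)) \<le> l ^ Suc m" by (simp add: algebra_simps)
    moreover obtain k where k: "k \<in> {0,1,2}" "k \<noteq> i" using lev(1) by force
    have "1 - 2 * (l ^ n * (1 - l)) < 1 - l ^ Suc m"
      using radial_hole_coords(1)[OF l lev(3,1) k] radial_hole_coords(3)[OF l lev(2,1) k]
      by (rule less_trans)
    ultimately show False by linarith
  qed
  have zero: "m = 0" if ij: "i \<in> {0,1,2}" "j \<in> {0,1,2}" "i \<noteq> j"
    and x: "x \<in> radial_hole l i m" "x \<in> radial_hole l j n" for i j m n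
  proof (rule ccontr)
    assume "m \<noteq> 0"
    then obtain m' where m: "m = Suc m'" using not0_implies_Suc by blast
    have "x \<in> contr l i ` radial_hole l i m'"
      using x(1) l radial_hole_Suc[OF _ ij(1), of l m'] by (simp add: m)
    then obtain y where y: "y \<in> radial_hole l i m'" "x = contr l i y" by blast
    have "y \<in> triangle" using radial_hole_subset_triangle[OF l ij(1)] y by blast
    hence "1 - l \<le> bary i x" using bary_contr_triangle_ge[OF _ ij(1)] l by (simp add: y)
    thus False using radial_hole_outside_cell[OF l x(2) ij(2,1,3)] by simp
  qed
  show ?thesis
  proof (cases "i = j")
    case True
    thus ?thesis using level[of i x m n] level[of i x n m] x ij by (metis nle_le)
  next
    case False
    hence "m = 0" "n = 0" using zero[OF ij False x] zero[OF ij(2,1) _ x(2,1)] by auto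
    thus ?thesis using radial_hole_0[OF ij(1)] radial_hole_0[OF ij(2)] by simp
  qed
qed

section \<open>Cross holes\<close>

text \<open>
  The \<open>j\<close>-th coordinate on \<open>f\<^sub>i(f\<^sub>j\<^sup>k(H\<^sub>0))\<close>, \<open>k \<ge> 1\<close>, is greater than \<open>l (1 - 2 l\<^sup>k (1 - l))\<close>. This bound
  is smallest for \<open>k = 1\<close>, and there it is at least \<open>1 - l\<close> exactly if \<open>2 (l\<^sup>3 - l\<^sup>2 + l) \<ge> 1\<close>.
\<close>

lemma cross_hole_in_cell:
  assumes l: "1/2 < l" "l < 1" "1/2 \<le> l^3 - l^2 + l"
    and ij: "i \<in> {0,1,2}" "j \<in> {0,1,2}" "i \<noteq> j" and q: "q \<in> radial_hole l j (Suc n)"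
  shows "1 - l \<le> bary j (contr l i q)"
proof -
  have "l * (1 - 2 * (l ^ Suc n * (1 - l))) \<le> l * bary j q"
    using radial_hole_coords(1)[OF l(1,2) q ij(2,1,3)] l by (intro mult_left_mono) auto
  moreover have "l ^ Suc n * (1 - l) \<le> l * (1 - l)"
    using l by (intro mult_right_mono) (auto intro: mult_left_le power_le_one)
  hence "l * (1 - 2 * (l * (1 - l))) \<le> l * (1 - 2 * (l ^ Suc n * (1 - l)))"
    using l by (intro mult_left_mono) auto
  ultimately show ?thesis using l ij
    by (simp add: bary_contr power2_eq_square power3_eq_cube algebra_simps)
qed

text \<open>
  A common point of \<open>f\<^sub>i(f\<^sub>j\<^sup>n\<^sup>+\<^sup>1(H\<^sub>0))\<close> and \<open>f\<^sub>j(f\<^sub>i\<^sup>m\<^sup>+\<^sup>1(H\<^sub>0))\<close> has two upper bounds for each of its three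
  coordinates. In every case one can choose a bound for each coordinate such that their sum is at
  most 1, contradicting that the coordinates sum to 1. By symmetry \<open>n \<le> m\<close>. If \<open>n < m\<close>, the third
  coordinate is bounded through the deeper hole and the other two through the shallower one. If
  \<open>n = m\<close>, the bounds are symmetric in \<open>i\<close> and \<open>j\<close>, and which one is useful for \<open>b\<^sub>i\<close> and \<open>b\<^sub>j\<close> depends on
  whether \<open>n = 0\<close>.
\<close>

lemma cross_holes_disjoint:
  assumes l: "0.647 < l" "l < 2/3" and ij: "i \<in> {0,1,2}" "j \<in> {0,1,2}" "i \<noteq> j"
    and q: "q \<in> radial_hole l j (Suc n)" and q': "q' \<in> radial_hole l i (Suc m)"
  shows "contr l i q \<noteq> contr l j q'"
  using assms(3-)
proof (induction n m arbitrary: i j q q' rule: linorder_wlog)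
  case (sym n m)
  show ?case using sym(1)[OF sym(3,2) sym(4)[symmetric] sym(6,5)] by metis
next
  case (le n m)
  note ij = le(2-4) and q = le(5) and q' = le(6)
  have l': "1/2 < l" "l < 1" using l by auto
  obtain k where k: "{0,1,2} = {i,j,k}" "k \<noteq> i" "k \<noteq> j" "\<And>x. bary i x + bary j x + bary k x = 1"
    using obtain_third_index[OF ij] by blast
  have k3: "k \<in> {0,1,2}" using k by blast
  show ?case
  proof
    assume eq: "contr l i q = contr l j q'"
    define p where "p = contr l i q"
    define t where "t = l ^ Suc n"
    define s where "s = l ^ Suc m"
    have pq': "p = contr l j q'" using eq by (simp add: p_def)
    have P: "0 < t" "0 < s" using l by (auto simp: t_def s_def)
    note c = radial_hole_coords(3,4)[OF l' q ij(2)] and c' = radial_hole_coords(3,4)[OF l' q' ij(1)]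
    have "l * bary i q < l * (t * (1 - l))" "l * bary j q < l * (1 - l * t)"
      using c(2)[OF ij(1,3)] c(1)[OF ij(1,3)] l by (simp_all add: t_def)
    hence 1: "bary i p < 1 - l + l * (t * (1 - l))" "bary j p < l * (1 - l * t)"
      using ij by (auto simp: p_def bary_contr)
    have "l * bary j q' < l * (s * (1 - l))" "l * bary i q' < l * (1 - l * s)" "l * bary k q' < l * (s * (1 - l))"
      using c'(2)[OF ij(2) ij(3)[symmetric]] c'(1)[OF ij(2) ij(3)[symmetric]] c'(2)[OF k3 k(2)] l by (simp_all add: s_def)
    hence 2: "bary j p < 1 - l + l * (s * (1 - l))" "bary i p < l * (1 - l * s)" "bary k p < l * (s * (1 - l))"
      using ij k3 k by (auto simp: pq' bary_contr)
    consider "n < m" | "n = m" "n = 0" | "n = m" "0 < n" using le(1) by force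
    thus False
    proof cases
      case 1
      have "s \<le> l ^ Suc (Suc n)" unfolding s_def using 1 l by (intro power_decreasing) auto
      hence "s \<le> l * t" by (simp add: t_def)
      hence "l * (s * (1 - l)) \<le> l * (l * t * (1 - l))"
        using l by (intro mult_left_mono mult_right_mono) auto
      hence "1 < 1 + (l * t) * (1 - l - l * l)"
        using \<open>bary i p < 1 - l + l * (t * (1 - l))\<close> \<open>bary j p < l * (1 - l * t)\<close> 2(3) k(4)[of p]
        by (simp add: algebra_simps)
      \<comment> \<open>\<open>1 - l - l\<^sup>2\<close> is negative because \<open>l\<close> is above the golden ratio conjugate \<open>0.618\<dots>\<close>\<close>
      moreover have "0.647 * 0.647 \<le> l * l" using l by (intro mult_mono) auto
      hence "1 - l - l * l < 0" using l by simp
      hence "(l * t) * (1 - l - l * l) < 0" using l P by (intro mult_pos_neg) auto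
      ultimately show False by simp
    next
      case 2
      have "t = l" "s = l" using 2 by (simp_all add: t_def s_def)
      hence "1 < 2 * (l * (1 - l * l)) + l * (l * (1 - l))"
        using \<open>bary i p < l * (1 - l * s)\<close> \<open>bary j p < l * (1 - l * t)\<close> \<open>bary k p < l * (s * (1 - l))\<close>
          k(4)[of p] by simp
      also have "\<dots> = (1 - l) * (2 * l + 3 * (l * l))" by (simp add: algebra_simps)
      also have "\<dots> \<le> 0.353 * (2 * (2/3) + 3 * (2/3 * (2/3)))"
        using l by (intro mult_mono add_mono) auto
      finally show False by simp
    next
      case 3
      have "s \<le> l ^ 2" "t \<le> l ^ 2" unfolding s_def t_def using 3 l by (intro power_decreasing; simp)+
      hence "l * (s * (1 - l)) \<le> l * (l ^ 2 * (1 - l))" "l * (t * (1 - l)) \<le> l * (l ^ 2 * (1 - l))"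
        using l by (intro mult_left_mono mult_right_mono; simp)+
      hence "1 < 2 * (1 - l) + 3 * (l * (l ^ 2 * (1 - l)))"
        using \<open>bary i p < 1 - l + l * (t * (1 - l))\<close> 2(1,3) k(4)[of p] by simp
      \<comment> \<open>\<open>l\<^sup>2 (1 - l)\<close> has on \<open>[0, 1]\<close> the maximum \<open>4/27\<close> at \<open>l = 2/3\<close>, and the resulting bound
        \<open>2 - 14 l / 9\<close> is below 1 for \<open>l > 9/14\<close>\<close>
      also have "\<dots> = 2 * (1 - l) + 3 * l * (4/27 - (l - 2/3)^2 * (l + 1/3))"
        by (simp add: field_simps power2_eq_square)
      also have "\<dots> \<le> 2 * (1 - l) + 3 * l * (4/27)"
        using l by (intro add_left_mono mult_left_mono) auto
      also have "\<dots> < 1" using l by simp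
      finally show False .
    qed
  qed
qed

section \<open>The invariant set is the triangle without the radial holes\<close>

definition sieve :: "real \<Rightarrow> (real ^ 2) set" where
  "sieve l = triangle - (\<Union>i\<in>{0,1,2}. \<Union>n. radial_hole l i n)"

text \<open>
  If the first preimage \<open>q\<close> of a point lies in a radial hole towards \<open>j\<close>, the preimage \<open>q'\<close> under \<open>f\<^sub>j\<close>
  does not lie in any: a hole towards \<open>i\<close> would contradict the disjointness of cross holes, and one
  towards the third vertex \<open>k\<close> would place the point in the cell at \<open>k\<close>, whereas its \<open>k\<close>-th coordinate,
  computed from \<open>q\<close>, is too small for that.
\<close>

lemma sieve_subset_images:
  assumes l: "0.647 < l" "l < 2/3" "1/2 \<le> l^3 - l^2 + l"
  shows "sieve l \<subseteq> (\<Union>i\<in>{0,1,2}. contr l i ` sieve l)"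
proof
  fix x assume x: "x \<in> sieve l"
  have l': "1/2 < l" "l < 1" "0 < l" using l by auto
  have xt: "x \<in> triangle" and nr: "\<And>i n. i \<in> {0,1,2} \<Longrightarrow> x \<notin> radial_hole l i n"
    using x by (auto simp: sieve_def)
  \<comment> \<open>The preimage in cell \<open>i\<close> is neither in \<open>H\<^sub>0\<close> nor in a hole towards \<open>i\<close>, since \<open>f\<^sub>i\<close> maps these to
    radial holes.\<close>
  have alt: "\<exists>q. q \<in> triangle \<and> x = contr l i q \<and>
      (q \<in> sieve l \<or> (\<exists>j\<in>{0,1,2}-{i}. \<exists>n. q \<in> radial_hole l j (Suc n)))"
    if i: "i \<in> {0,1,2}" and ge: "1 - l \<le> bary i x" for i
  proof -
    obtain q where q: "q \<in> triangle" "x = contr l i q"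
      using contr_triangle_preimage[OF l'(3,2) i xt ge] .
    have own: "q \<notin> radial_hole l i n" for n
      using nr[OF i, of "Suc n"] contr_mem_radial_hole_Suc[OF l'(3) i] q(2) by simp
    have "j \<noteq> i \<and> (\<exists>m. n = Suc m)" if "j \<in> {0,1,2}" "q \<in> radial_hole l j n" for j n
      using that own[of n] own[of 0] radial_hole_0[OF i] radial_hole_0[OF that(1)] by (cases n) auto
    thus ?thesis using q unfolding sieve_def by blast
  qed
  obtain i where i: "i \<in> {0,1,2}" "1 - l \<le> bary i x"
    using nr[of 0 0] radial_hole_0[of 0 l] by (force simp: not_less)
  obtain q where q: "q \<in> triangle" "x = contr l i q"
    "q \<in> sieve l \<or> (\<exists>j\<in>{0,1,2}-{i}. \<exists>n. q \<in> radial_hole l j (Suc n))"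
    using alt[OF i] by blast
  show "x \<in> (\<Union>i\<in>{0,1,2}. contr l i ` sieve l)"
  proof (cases "q \<in> sieve l")
    case True
    thus ?thesis using i q by blast
  next
    case False
    then obtain j n where jn: "j \<in> {0,1,2} - {i}" "q \<in> radial_hole l j (Suc n)"
      using q(3) by metis
    hence j: "j \<in> {0,1,2}" "i \<noteq> j" "q \<in> radial_hole l j (Suc n)" by auto
    have "1 - l \<le> bary j x"
      using cross_hole_in_cell[OF l'(1,2) l(3) i(1) j] q(2) by simp
    then obtain q' where q': "x = contr l j q'"
      "q' \<in> sieve l \<or> (\<exists>k\<in>{0,1,2}-{j}. \<exists>m. q' \<in> radial_hole l k (Suc m))"
      using alt[OF j(1)] by blast
    have False if k: "k \<in> {0,1,2}" "k \<noteq> j" "q' \<in> radial_hole l k (Suc m)" for k m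
    proof (cases "k = i")
      case True
      thus False using cross_holes_disjoint[OF l(1,2) i(1) j, of q' m] k(3) q(2) q'(1) by metis
    next
      case False
      have "1 - l \<le> bary k x"
        using cross_hole_in_cell[OF l'(1,2) l(3) j(1) k(1) _ k(3)] k(2) q'(1) by simp
      moreover have "0 < bary k q" "bary k q < 1 - l"
        using radial_hole_coords(2)[OF l'(1,2) j(3,1) k(1,2)] radial_hole_outside_cell[OF l'(1,2) j(3,1) k(1,2)] .
      hence "l * bary k q < 1 * (1 - l)" using l by (intro mult_strict_mono) auto
      ultimately show False using False i k by (simp add: q(2) bary_contr)
    qed
    thus ?thesis using q' j by blast
  qed
qed

text \<open>
  Each point of such a set \<open>A\<close> is an image under some \<open>n\<close>-fold composition of the contractions of a
  point of \<open>A\<close>, so its distance to the invariant set is at most \<open>l\<^sup>n\<close> times a constant, for all \<open>n\<close>.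
\<close>

lemma subset_invariant_setI:
  assumes l: "0 < l" "l < 1" and A: "bounded A" "A \<subseteq> (\<Union>i\<in>{0,1,2}. contr l i ` A)"
  shows "A \<subseteq> invariant_set l"
proof
  fix a assume a: "a \<in> A"
  let ?S = "invariant_set l"
  have S: "?S \<noteq> {}" "compact ?S" "?S = (\<Union>i\<in>{0,1,2}. contr l i ` ?S)"
    using is_invariant_set_invariant_set[OF l] unfolding is_invariant_set_def by blast+
  obtain s where s: "s \<in> ?S" using S by blast
  obtain M where M: "\<And>y. y \<in> A \<Longrightarrow> dist s y \<le> M" using A(1) bounded_any_center by blast
  have bound: "y \<in> A \<Longrightarrow> infdist y ?S \<le> l ^ n * M" for n y
  proof (induction n arbitrary: y)
    case 0
    show ?case using infdist_le[OF s, of y] M[OF 0] by (simp add: dist_commute)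
  next
    case (Suc n)
    obtain i z where z: "i \<in> {0,1,2}" "z \<in> A" "y = contr l i z" using Suc.prems A(2) by blast
    obtain t where t: "t \<in> ?S" "infdist z ?S = dist z t"
      using infdist_attains_inf[OF compact_imp_closed[OF S(2)] S(1)] by blast
    have "contr l i t \<in> ?S" using S(3) z(1) t(1) by blast
    hence "infdist y ?S \<le> dist y (contr l i t)" by (rule infdist_le)
    also have "\<dots> = l * infdist z ?S" using l by (simp add: z(3) contr_dist t(2))
    also have "\<dots> \<le> l * (l ^ n * M)" using l Suc.IH[OF z(2)] by (intro mult_left_mono) auto
    finally show ?case by simp
  qed
  have "(\<lambda>n. l ^ n * M) \<longlonglongrightarrow> 0 * M" using l by (intro tendsto_mult tendsto_const LIMSEQ_realpow_zero) auto
  hence "infdist a ?S \<le> 0" using bound[OF a] by (intro LIMSEQ_le_const[of _ 0]) auto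
  hence "infdist a ?S = 0" using infdist_nonneg[of a ?S] by linarith
  thus "a \<in> ?S" using in_closed_iff_infdist_zero[OF compact_imp_closed[OF S(2)] S(1)] by blast
qed

lemma invariant_set_eq_sieve:
  assumes l: "0.647 < l" "l < 2/3" "1/2 \<le> l^3 - l^2 + l"
  shows "invariant_set l = sieve l"
proof
  have l': "1/2 < l" "l < 1" "0 < l" using l by auto
  show "invariant_set l \<subseteq> sieve l"
    using invariant_set_subset_triangle[OF l'(3,2)] radial_hole_disjoint_invariant_set[OF l'(1,2)]
    unfolding sieve_def by blast
  have "bounded triangle" unfolding triangle_def by (intro bounded_convex_hull) auto
  hence "bounded (sieve l)" by (rule bounded_subset) (auto simp: sieve_def)
  thus "sieve l \<subseteq> invariant_set l"
    by (rule subset_invariant_setI[OF l'(3,2)]) (rule sieve_subset_images[OF l])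
qed

text \<open>
  A radial hole towards \<open>i\<close> has \<open>b\<^sub>j < 1 - l\<close> for \<open>j \<noteq> i\<close>, so none meets the open part of the triangle
  where two coordinates exceed \<open>1 - l\<close>. That part is nonempty because \<open>2 (1 - l) < 1\<close>.
\<close>

lemma sieve_interior_nonempty:
  assumes l: "1/2 < l" "l < 1"
  shows "interior (sieve l) \<noteq> {}"
proof -
  define U where "U = {x. 1 - l < bary 0 x} \<inter> {x. 1 - l < bary 1 x} \<inter> {x. 0 < bary 2 x}"
  have "open U" unfolding U_def by (intro open_Int open_bary_greater)
  moreover have "U \<subseteq> sieve l"
  proof
    fix x assume x: "x \<in> U"
    have "x \<in> triangle" using x l by (auto simp: U_def triangle_bary)
    moreover have "x \<notin> radial_hole l i n" if "i \<in> {0,1,2}" for i n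
    proof
      assume r: "x \<in> radial_hole l i n"
      define j :: nat where "j = (if i = 0 then 1 else 0)"
      have j: "j \<in> {0,1}" "j \<noteq> i" by (auto simp: j_def)
      have "j \<in> {0,1,2}" using j by blast
      hence "bary j x < 1 - l" using radial_hole_outside_cell[OF l r that] j by blast
      thus False using x j(1) by (auto simp: U_def)
    qed
    ultimately show "x \<in> sieve l" by (auto simp: sieve_def)
  qed
  \<comment> \<open>The coordinates \<open>b\<^sub>0 = b\<^sub>1 = 3/4 - l/2\<close> of this point are halfway between \<open>1 - l\<close> and \<open>1/2\<close>; the
    factor 1 brings the combination into the two-term form of \<open>bary_affine\<close>.\<close>
  moreover have "(l - 1/2) *\<^sub>R vertex 2 + 1 *\<^sub>R ((3/4 - l/2) *\<^sub>R vertex 0 + (3/4 - l/2) *\<^sub>R vertex 1) \<in> U"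
    using l by (simp only: U_def Int_iff mem_Collect_eq bary_affine)
      (auto simp: bary_vertex field_simps)
  ultimately show ?thesis using interior_maximal by blast
qed

section \<open>The holes are the radial holes\<close>

theorem proposition2p7:
  fixes l :: real
  assumes "lambda_star \<le> l" and "l < 2/3"
  shows "interior (invariant_set l) \<noteq> {} \<and> (\<forall>H. is_hole l H \<longrightarrow> is_radial l H)"
proof -
  have l: "0.647 < l" using lambda_star_approx assms(1) by (auto simp: abs_if split: if_splits)
  have l': "1/2 < l" "l < 1" "0 < l" using l assms(2) by auto
  have cubic: "1/2 \<le> l^3 - l^2 + l"
    using assms(1) cubic_strict_mono[of lambda_star l] lambda_star_root
    by (cases "lambda_star = l") auto
  note eq = invariant_set_eq_sieve[OF l assms(2) cubic]
  define R where "R = (\<Union>i\<in>{0,1,2}. range (radial_hole l i))"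
  have "triangle - invariant_set l = \<Union>R"
    using radial_hole_subset_triangle[OF l'(1,2)] unfolding eq sieve_def R_def by blast
  moreover have "components (\<Union>R) = R"
  proof (rule components_open_unique)
    show "pairwise disjnt R"
      using radial_hole_disjoint[OF l'(1,2)] unfolding pairwise_def disjnt_def R_def by blast
    show "open X \<and> connected X \<and> X \<noteq> {}" if "X \<in> R" for X
      using that radial_hole_open radial_hole_convex convex_connected
        radial_hole_nonempty[OF l'(3) assms(2)] unfolding R_def by blast
  qed simp
  ultimately have "is_radial l H" if "is_hole l H" for H
    using that funpow_contr_central_hole[OF l'(1,2)]
    unfolding is_hole_def is_radial_def R_def by auto
  thus ?thesis using sieve_interior_nonempty[OF l'(1,2)] eq by simp
qed

end
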